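(* Let $A\in\mathbb{C}^{n\times n}$ be half-radial, i.e., $A$ is nonzero and $\|A\|=2r(A)$. Let $m$ denote the multiplicity of the largest singular value $\sigma_{max}$ of $A$. Then: 1. $\mathcal{V}_{max}(A)\subseteq\mathcal{R}(A^* )\cap\mathcal{N}(A^* )$ and $\mathcal{U}_{max}(A)\subseteq\mathcal{R}(A)\cap\mathcal{N}(A)$; 2. $\mathcal{V}_{max}(A)\perp\mathcal{U}_{max}(A)$; 3. $m$ is not greater than $n/2$; 4. the multiplicity of the zero singular value of $A$ is at least $m$.
   Context: $\|\cdot\|$ is the matrix 2-norm, $\langle z,w\rangle=w^*z$ the Euclidean inner product on $\mathbb{C}^n$, $r(A)=\max_{\|z\|=1}|\langle Az,z\rangle|$ the numerical radius, and $*$ the Hermitian transpose. $\mathcal{R}(\cdot)$ and $\mathcal{N}(\cdot)$ denote range and null space. $\sigma_{max}=\|A\|$ is the largest singular value of $A$. $\mathcal{V}_{max}(A)=\{x\in\mathbb{C}^n:\|Ax\|=\|A\|\|x\|\}$ is the maximum right singular subspace (the span of right singular vectors corresponding to $\sigma_{max}$), and $\mathcal{U}_{max}(A)$ is the maximum left singular subspace (the span of left singular vectors corresponding to $\sigma_{max}$). *)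

theory Defs
  imports "HOL-Analysis.Analysis" "HOL-Computational_Algebra.Polynomial"
begin

definition hermitian_transpose :: "complex^'n^'m \<Rightarrow> complex^'m^'n" where
  "hermitian_transpose A = (\<chi> i j. cnj (A $ j $ i))"

(* \<langle>z, w\<rangle> = w\<^sup>* z: linear in the first argument, conjugate-linear in the second *)
definition cdot :: "complex^'n \<Rightarrow> complex^'n \<Rightarrow> complex" where
  "cdot z w = (\<Sum>i\<in>UNIV. cnj (w $ i) * z $ i)"

abbreviation norm2 :: "complex^'n^'n \<Rightarrow> real" where
  "norm2 A \<equiv> onorm ((*v) A)"

(* The unit sphere is compact and nonempty, so this supremum is a maximum. *)
definition numerical_radius :: "complex^'n^'n \<Rightarrow> real" where
  "numerical_radius A = (SUP z\<in>{z. norm z = 1}. cmod (cdot (A *v z) z))"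

definition half_radial :: "complex^'n^'n \<Rightarrow> bool" where
  "half_radial A \<longleftrightarrow> A \<noteq> 0 \<and> norm2 A = 2 * numerical_radius A"

definition range_space :: "complex^'n^'n \<Rightarrow> (complex^'n) set" where
  "range_space A = range ((*v) A)"

definition null_space :: "complex^'n^'n \<Rightarrow> (complex^'n) set" where
  "null_space A = {x. A *v x = 0}"

(* det (X I - A), computed over the polynomial ring *)
definition charpoly :: "complex^'n^'n \<Rightarrow> complex poly" where
  "charpoly A = det (mat [:0, 1:] - map_matrix (\<lambda>c. [:c:]) A)"

(* The singular values of A are the nonnegative square roots of the eigenvalues of A\<^sup>* A,
   counted with (algebraic) multiplicity. *)
definition singular_values :: "complex^'n^'n \<Rightarrow> real set" where
  "singular_values A =
     {\<sigma>. 0 \<le> \<sigma> \<and> poly (charpoly (hermitian_transpose A ** A)) (of_real (\<sigma>\<^sup>2)) = 0}"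

(* Meaningful for \<sigma> \<ge> 0; it is 0 if such a \<sigma> is not a singular value of A. *)
definition sv_multiplicity :: "complex^'n^'n \<Rightarrow> real \<Rightarrow> nat" where
  "sv_multiplicity A \<sigma> = order (of_real (\<sigma>\<^sup>2)) (charpoly (hermitian_transpose A ** A))"

definition sigma_max :: "complex^'n^'n \<Rightarrow> real" where
  "sigma_max A = Max (singular_values A)"

definition left_singular_vector :: "complex^'n^'n \<Rightarrow> real \<Rightarrow> complex^'n \<Rightarrow> bool" where
  "left_singular_vector A \<sigma> u \<longleftrightarrow>
     norm u = 1 \<and>
     (\<exists>v. norm v = 1 \<and> A *v v = of_real \<sigma> *s u \<and> hermitian_transpose A *v u = of_real \<sigma> *s v)"

definition V_max :: "complex^'n^'n \<Rightarrow> (complex^'n) set" where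
  "V_max A = {x. norm (A *v x) = norm2 A * norm x}"

(* vec.span is the span over the complex field (plain span would be over the reals). *)
definition U_max :: "complex^'n^'n \<Rightarrow> (complex^'n) set" where
  "U_max A = vec.span {u. left_singular_vector A (sigma_max A) u}"

end

theory Submission
  imports Defs
begin

text \<open>Write \<open>s = \<parallel>A\<parallel>\<close>, take \<open>v\<close> with \<open>\<parallel>A v\<parallel> = s \<parallel>v\<parallel>\<close> and put \<open>u = A v / s\<close>, so that
\<open>A\<^sup>* u = s v\<close> and \<open>\<parallel>u\<parallel> = \<parallel>v\<parallel>\<close>. Being half-radial means that \<open>Re (c \<langle>A z, z\<rangle>) \<le> (s/2) \<parallel>z\<parallel>\<^sup>2\<close>
for every vector \<open>z\<close> and every \<open>c\<close> of modulus one. Testing this at \<open>z = v + c u\<close>, the leading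
terms on the two sides cancel and what remains is
\<open>Re (c \<langle>A u, u\<rangle> + c\<^sup>2 \<langle>A u, v\<rangle>) \<le> 0\<close>. The four values \<open>c = 1, -1, \<i>, -\<i>\<close> already force the real
parts of both inner products to vanish, so that equality holds for \<open>c = 1\<close> and \<open>c = -1\<close>.
Thus \<open>v + u\<close> and \<open>v - u\<close> are maximizers of the quadratic forms of the Hermitian matrices
\<open>A + A\<^sup>*\<close> and \<open>-(A + A\<^sup>*)\<close>, hence eigenvectors for the eigenvalue \<open>s\<close>. These two eigenvector
equations read \<open>A u + A\<^sup>* v = 0\<close> and \<open>A u - A\<^sup>* v = 0\<close>, whence \<open>A u = 0\<close> and \<open>A\<^sup>* v = 0\<close>
(lemma \<open>half_radial_V_max\<close>). The two inclusions follow, because \<open>v\<close> is a multiple of \<open>A\<^sup>* u\<close> and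
\<open>u\<close> is one of \<open>A v\<close>; the two spaces are orthogonal because one lies in the range of \<open>A\<^sup>*\<close> and the
other in the null space of \<open>A\<close>.

The multiplicities are algebraic, as roots of the characteristic polynomial of \<open>A\<^sup>* A\<close>. Since
Hermitian matrices are diagonalizable, they are the dimensions of the eigenspaces
(lemma \<open>order_charpoly_hermitian\<close>), and these are the maximum right singular subspace for the value
\<open>s\<close> and the null space of \<open>A\<close> for the value 0. By the first part, \<open>A\<close> maps the former injectively
into the latter, which gives \<open>m \<le> dim (null space)\<close>; as the two meet only in 0, also
\<open>2 m \<le> m + dim (null space) \<le> n\<close>.

Maximization of quadratic forms only concerns the real inner product, which is the real part of
the Hermitian one; that part of the argument is therefore carried out over the reals.\<close>

section \<open>Self-adjoint maps on a Euclidean space\<close>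

text \<open>The form of \<open>\<mu> - f\<close> is nonnegative on \<open>S\<close> and vanishes at \<open>z\<close>. Its first variation at \<open>z\<close> in the
direction \<open>w = \<mu> z - f z\<close>, which again lies in \<open>S\<close>, is \<open>2 \<parallel>w\<parallel>\<^sup>2\<close> and must be zero.\<close>

lemma selfadjoint_maximizer_is_eigenvector:
  fixes f :: "'a::real_inner \<Rightarrow> 'a"
  assumes lin: "linear f" and sa: "\<And>x y. f x \<bullet> y = x \<bullet> f y"
    and S: "subspace S" and inv: "f ` S \<subseteq> S"
    and bound: "\<And>x. x \<in> S \<Longrightarrow> f x \<bullet> x \<le> \<mu> * (x \<bullet> x)"
    and z: "z \<in> S" and eq: "f z \<bullet> z = \<mu> * (z \<bullet> z)"
  shows "f z = \<mu> *\<^sub>R z"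
proof -
  interpret f: linear f by (rule lin)
  define w where "w = \<mu> *\<^sub>R z - f z"
  define q where "q = \<mu> * (w \<bullet> w) - f w \<bullet> w"
  have wS: "w \<in> S"
    unfolding w_def using z inv S by (auto intro!: subspace_diff subspace_scale)
  have key: "0 \<le> 2 * t * (w \<bullet> w) + t\<^sup>2 * q" for t :: real
  proof -
    have "z + t *\<^sub>R w \<in> S" using z wS S by (auto intro!: subspace_add subspace_scale)
    from bound[OF this]
    have "f z \<bullet> z + t * (f z \<bullet> w) + t * (f w \<bullet> z) + t\<^sup>2 * (f w \<bullet> w)
          \<le> \<mu> * (z \<bullet> z) + 2 * t * \<mu> * (z \<bullet> w) + t\<^sup>2 * \<mu> * (w \<bullet> w)"
      by (simp add: f.add f.scale inner_simps inner_commute power2_eq_square algebra_simps)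
    moreover have "f w \<bullet> z = f z \<bullet> w" using sa[of w z] by (simp add: inner_commute)
    moreover have "w \<bullet> w = \<mu> * (z \<bullet> w) - f z \<bullet> w"
      by (subst (1) w_def) (simp add: inner_simps)
    then have "2 * t * (w \<bullet> w) = 2 * t * \<mu> * (z \<bullet> w) - 2 * t * (f z \<bullet> w)"
      by (simp only: right_diff_distrib mult.assoc)
    moreover have "t\<^sup>2 * q = t\<^sup>2 * \<mu> * (w \<bullet> w) - t\<^sup>2 * (f w \<bullet> w)"
      by (simp add: q_def algebra_simps)
    ultimately show ?thesis using eq by simp
  qed
  have "w \<bullet> w = 0"
  proof (rule ccontr)
    assume "w \<bullet> w \<noteq> 0"
    then have p: "w \<bullet> w > 0" using inner_ge_zero[of w] by linarith
    \<comment> \<open>a negative step so short that the quadratic term cannot compensate the linear one\<close>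
    define t where "t = - (w \<bullet> w) / (\<bar>q\<bar> + 1)"
    have t: "t < 0" using p unfolding t_def by (simp add: divide_neg_pos)
    have "t * (2 * (w \<bullet> w) + t * q) \<ge> 0"
      using key[of t] by (simp add: power2_eq_square algebra_simps)
    then have "2 * (w \<bullet> w) + t * q \<le> 0" using t by (simp add: zero_le_mult_iff)
    moreover have "\<bar>t * q\<bar> \<le> w \<bullet> w"
      using p by (simp add: t_def abs_mult field_simps)
    ultimately show False using p by linarith
  qed
  then show ?thesis by (simp add: w_def)
qed

text \<open>The orthogonal complement of all eigenvectors is invariant. If it were nonzero, the form of \<open>f\<close>
would attain a maximum on its unit sphere, at an eigenvector orthogonal to itself.\<close>

lemma span_eigenvectors_selfadjoint:
  fixes f :: "'a::euclidean_space \<Rightarrow> 'a"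
  assumes lin: "linear f" and sa: "\<And>x y. f x \<bullet> y = x \<bullet> f y"
  shows "span {x. \<exists>\<mu>. f x = \<mu> *\<^sub>R x} = UNIV"
proof (rule ccontr)
  let ?E = "{x. \<exists>\<mu>. f x = \<mu> *\<^sub>R x}"
  assume "span ?E \<noteq> UNIV"
  then obtain a where a: "a \<noteq> 0" "\<forall>x\<in>span ?E. a \<bullet> x = 0"
    using span_not_UNIV_orthogonal by blast
  define S where "S = {x. \<forall>w\<in>?E. w \<bullet> x = 0}"
  have S: "subspace S" unfolding S_def
    by (auto simp: subspace_def inner_simps)
  have clS: "closed S" by (rule closed_subspace[OF S])
  have inv: "f ` S \<subseteq> S"
  proof (clarsimp simp: S_def)
    fix x w \<mu> assume x: "\<forall>w. (\<exists>\<mu>. f w = \<mu> *\<^sub>R w) \<longrightarrow> w \<bullet> x = 0" and w: "f w = \<mu> *\<^sub>R w"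
    have "w \<bullet> f x = \<mu> *\<^sub>R w \<bullet> x" using sa[of w x] w by simp
    then show "w \<bullet> f x = 0" using x w by auto
  qed
  have aS: "a \<in> S" unfolding S_def using a(2) by (auto simp: inner_commute intro: span_base)
  define C where "C = sphere 0 1 \<inter> S"
  have "compact C" unfolding C_def by (intro compact_Int_closed compact_sphere clS)
  moreover have "C \<noteq> {}"
  proof -
    have "(1 / norm a) *\<^sub>R a \<in> C"
      using a(1) aS S by (auto simp: C_def intro: subspace_scale)
    then show ?thesis by blast
  qed
  moreover have "continuous_on C (\<lambda>x. f x \<bullet> x)"
    using lin by (intro continuous_intros linear_continuous_on) (auto simp: linear_conv_bounded_linear)
  ultimately obtain z where z: "z \<in> C" and max: "\<And>x. x \<in> C \<Longrightarrow> f x \<bullet> x \<le> f z \<bullet> z"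
    using continuous_attains_sup[of C "\<lambda>x. f x \<bullet> x"] by blast
  have zz: "z \<bullet> z = 1" and zS: "z \<in> S" using z by (auto simp: C_def norm_eq_1)
  have "f z = (f z \<bullet> z) *\<^sub>R z"
  proof (rule selfadjoint_maximizer_is_eigenvector[OF lin sa S inv _ zS])
    fix x assume x: "x \<in> S"
    show "f x \<bullet> x \<le> (f z \<bullet> z) * (x \<bullet> x)"
    proof (cases "x = 0")
      case True then show ?thesis by simp
    next
      case False
      interpret f: linear f by (rule lin)
      have "(1 / norm x) *\<^sub>R x \<in> C" using False x S by (auto simp: C_def intro: subspace_scale)
      from max[OF this] have "(f x \<bullet> x) / (norm x)\<^sup>2 \<le> f z \<bullet> z"
        by (simp add: f.scale power2_eq_square)
      then show ?thesis using False by (simp add: field_simps dot_square_norm)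
    qed
  qed (simp add: zz)
  then have "z \<in> ?E" by auto
  then have "z \<bullet> z = 0" using zS by (auto simp: S_def)
  then show False using zz by simp
qed

section \<open>The complex Euclidean space as a real one\<close>

lemma scaleR_eq_smult: "c *\<^sub>R x = complex_of_real c *s (x :: complex^'n)"
  by (simp add: vec_eq_iff) (simp add: scaleR_conv_of_real)

lemma matrix_vector_mult_smult: "A *v (c *s x) = c *s (A *v x)" for A :: "complex^'n^'m"
  by (simp add: vec_eq_iff matrix_vector_mult_def sum_distrib_left algebra_simps)

lemma linear_matrix_vector: "linear ((*v) A)" for A :: "complex^'n^'m"
  by (rule bounded_linear.linear) (rule matrix_vector_mul_bounded_linear)

lemma Re_cdot: "Re (cdot z w) = z \<bullet> w"
  by (simp add: cdot_def inner_vec_def inner_complex_def algebra_simps)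

lemma cdot_smult_left: "cdot (c *s z) w = c * cdot z w"
  by (simp add: cdot_def sum_distrib_left algebra_simps)

lemma cdot_hermitian_transpose: "cdot (A *v x) y = cdot x (hermitian_transpose A *v y)"
proof -
  have "cdot (A *v x) y = (\<Sum>i\<in>UNIV. \<Sum>j\<in>UNIV. cnj (y $ i) * A $ i $ j * x $ j)"
    by (simp add: cdot_def matrix_vector_mult_def sum_distrib_left mult.assoc)
  also have "\<dots> = (\<Sum>j\<in>UNIV. \<Sum>i\<in>UNIV. cnj (y $ i) * A $ i $ j * x $ j)"
    by (rule sum.swap)
  also have "\<dots> = cdot x (hermitian_transpose A *v y)"
    by (simp add: cdot_def matrix_vector_mult_def hermitian_transpose_def sum_distrib_right
        sum_distrib_left algebra_simps)
  finally show ?thesis .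
qed

lemma hermitian_transpose_idem [simp]: "hermitian_transpose (hermitian_transpose A) = A"
  by (simp add: hermitian_transpose_def vec_eq_iff)

text \<open>The real inner product sees the Hermitian transpose as the adjoint, so that the results on real
self-adjoint maps apply to Hermitian matrices.\<close>

lemma inner_hermitian_transpose: "(A *v x) \<bullet> y = x \<bullet> (hermitian_transpose A *v y)"
  for A :: "complex^'n^'n"
  by (simp add: Re_cdot [symmetric] cdot_hermitian_transpose)

lemma hermitian_gram: "hermitian_transpose (hermitian_transpose A ** A) = hermitian_transpose A ** A"
  by (simp add: hermitian_transpose_def matrix_matrix_mult_def vec_eq_iff cnj_sum mult.commute[of _ "cnj _"])

section \<open>Characteristic polynomials of Hermitian matrices\<close>

definition diagonal_matrix :: "('n \<Rightarrow> complex) \<Rightarrow> complex^'n^'n" where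
  "diagonal_matrix d = (\<chi> i j. if i = j then d i else 0)"

lemma diagonal_matrix_vector: "(diagonal_matrix d *v x) $ i = d i * x $ i"
  by (simp add: diagonal_matrix_def matrix_vector_mult_def if_distrib [of "\<lambda>a. a * _"] sum.delta
      cong: if_cong)

text \<open>The eigenvectors span over the reals, hence over the complex numbers; a complex basis extracted
from them gives the columns of \<open>P\<close>.\<close>

lemma hermitian_diagonalizable:
  fixes B :: "complex^'n^'n"
  assumes B: "hermitian_transpose B = B"
  obtains P Q :: "complex^'n^'n" and d where "P ** Q = mat 1" "B ** P = P ** diagonal_matrix d"
proof -
  let ?E = "{x. \<exists>\<mu>. B *v x = \<mu> *\<^sub>R x}"
  have "span ?E = UNIV"
    by (rule span_eigenvectors_selfadjoint[OF linear_matrix_vector])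
      (simp add: inner_hermitian_transpose B)
  moreover have "span ?E \<subseteq> vec.span ?E"
    by (rule span_minimal)
      (auto simp: subspace_def scaleR_eq_smult vec.span_zero
        intro: vec.span_base vec.span_add vec.span_scale)
  ultimately have spanE: "vec.span ?E = UNIV" by auto
  obtain W where W: "W \<subseteq> ?E" "vec.independent W" "?E \<subseteq> vec.span W"
    using vec.maximal_independent_subset by blast
  have spanW: "vec.span W = UNIV"
    using vec.span_mono[OF W(3)] spanE by (simp only: vec.span_span UNIV_I top.extremum_unique)
  have "card W = CARD('n)"
    using vec.dim_eq_card[OF _ W(2), of UNIV] spanW by (simp add: card_cart_basis)
  moreover have "finite W" by (rule vec.finiteI_independent[OF W(2)])
  ultimately obtain e where e: "bij_betw e (UNIV :: 'n set) W"
    by (metis finite_class.finite_UNIV finite_same_card_bij)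
  have "\<forall>i. \<exists>\<mu>. B *v e i = \<mu> *\<^sub>R e i"
    using W(1) bij_betwE[OF e] by blast
  then obtain \<mu> where \<mu>: "\<And>i. B *v e i = \<mu> i *\<^sub>R e i" by metis
  define P where "P = (\<chi> i j. e j $ i)"
  have col: "column j P = e j" for j by (simp add: P_def column_def vec_eq_iff)
  have "columns P = W"
    using bij_betw_imp_surj_on[OF e] by (auto simp: columns_def col)
  then obtain Q where "P ** Q = mat 1"
    using matrix_right_invertible_span_columns[of P] spanW by auto
  moreover have "B ** P = P ** diagonal_matrix (\<lambda>i. of_real (\<mu> i))"
  proof (simp add: vec_eq_iff, intro allI)
    fix i j
    have "(B ** P) $ i $ j = (B *v e j) $ i"
      by (simp add: matrix_matrix_mult_def matrix_vector_mult_def P_def)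
    also have "\<dots> = P $ i $ j * of_real (\<mu> j)"
      by (simp add: \<mu> P_def scaleR_eq_smult mult.commute)
    also have "\<dots> = (P ** diagonal_matrix (\<lambda>i. of_real (\<mu> i))) $ i $ j"
      by (simp add: matrix_matrix_mult_def diagonal_matrix_def if_distrib [of "\<lambda>a. _ * a"] sum.delta
          cong: if_cong)
    finally show "(B ** P) $ i $ j = (P ** diagonal_matrix (\<lambda>i. of_real (\<mu> i))) $ i $ j" .
  qed
  ultimately show thesis by (rule that)
qed

lemma const_poly_sum: "[:sum f S:] = (\<Sum>i\<in>S. [:f i:])"
proof (induction S rule: infinite_finite_induct)
  case (insert x F)
  then show ?case using add_pCons[of "f x" 0 "sum f F" 0] by (simp del: add_pCons)
qed auto

lemma const_poly_matrix_mult: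
  "map_matrix (\<lambda>c. [:c:]) (A ** B) = map_matrix (\<lambda>c. [:c:]) A ** map_matrix (\<lambda>c. [:c:]) B"
  for A B :: "complex^'n^'n"
  by (simp add: vec_eq_iff matrix_matrix_mult_def const_poly_sum mult.commute)

text \<open>The similarity is lifted to matrices over the polynomial ring, where \<open>P\<close> becomes a matrix of
constant polynomials. It commutes with the scalar matrix \<open>X I\<close>, and its determinant is a unit, which
can be cancelled.\<close>

lemma charpoly_similar:
  fixes B D P Q :: "complex^'n^'n"
  assumes PQ: "P ** Q = mat 1" and sim: "B ** P = P ** D"
  shows "charpoly B = charpoly D"
proof -
  let ?c = "map_matrix (\<lambda>c. [:c:]) :: complex^'n^'n \<Rightarrow> complex poly^'n^'n"
  let ?X = "mat [:0, 1:] :: complex poly^'n^'n"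
  have X: "?X ** ?c P = ?c P ** ?X"
    by (simp add: vec_eq_iff matrix_matrix_mult_def mat_def mult_delta_left mult_delta_right
        if_distrib [of "smult _"] sum.delta' cong: if_cong)
  have "(?X - ?c B) ** ?c P = ?X ** ?c P - ?c B ** ?c P"
    by (simp add: vec_eq_iff matrix_matrix_mult_def sum_subtractf left_diff_distrib smult_diff_right)
  also have "\<dots> = ?c P ** ?X - ?c P ** ?c D"
    by (simp add: X const_poly_matrix_mult [symmetric] sim)
  also have "\<dots> = ?c P ** (?X - ?c D)"
    by (simp add: vec_eq_iff matrix_matrix_mult_def sum_subtractf right_diff_distrib)
  finally have "det (?X - ?c B) * det (?c P) = det (?c P) * det (?X - ?c D)"
    by (metis det_mul)
  moreover have "det (?c P) \<noteq> 0"
  proof -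
    have "?c (mat 1) = mat 1" by (simp add: vec_eq_iff mat_def)
    then have "det (?c P) * det (?c Q) = 1"
      by (metis PQ const_poly_matrix_mult det_I det_mul)
    then show ?thesis by auto
  qed
  ultimately show ?thesis by (simp add: charpoly_def)
qed

lemma charpoly_diagonal: "charpoly (diagonal_matrix d) = (\<Prod>i\<in>UNIV. [:- d i, 1:])"
  unfolding charpoly_def
  by (subst det_diagonal) (auto simp: mat_def diagonal_matrix_def)

lemma order_prod_linear:
  fixes d :: "'i \<Rightarrow> complex"
  assumes "finite S"
  shows "order a (\<Prod>i\<in>S. [:- d i, 1:]) = card {i\<in>S. d i = a}"
  using assms
proof (induction S)
  case (insert k S)
  have "order a [:- d k, 1:] = (if d k = a then 1 else 0)"
    using order_power_n_n[of a 1] by (auto intro: order_0I)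
  moreover have "order a (\<Prod>i\<in>insert k S. [:- d i, 1:])
      = order a [:- d k, 1:] + order a (\<Prod>i\<in>S. [:- d i, 1:])"
    using insert by (simp del: mult_pCons_left add: order_mult)
  moreover have "{i \<in> insert k S. d i = a} = (if d k = a then insert k {i\<in>S. d i = a} else {i\<in>S. d i = a})"
    by auto
  ultimately show ?case using insert by simp
qed simp

text \<open>Algebraic and geometric multiplicity agree: both count the occurrences of \<open>a\<close> on the diagonal
of a diagonalization.\<close>

lemma order_charpoly_hermitian:
  fixes B :: "complex^'n^'n"
  assumes "hermitian_transpose B = B"
  shows "order a (charpoly B) = vec.dim {x. B *v x = a *s x}"
proof -
  obtain P Q :: "complex^'n^'n" and d where PQ: "P ** Q = mat 1" and BP: "B ** P = P ** diagonal_matrix d"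
    using hermitian_diagonalizable[OF assms] by metis
  let ?D = "diagonal_matrix d"
  let ?S = "{c :: complex^'n. \<forall>i. i \<notin> {i. d i = a} \<longrightarrow> c $ i = 0}"
  have QP: "Q ** P = mat 1" using PQ matrix_left_right_inverse by blast
  have inj: "inj ((*v) P)" using QP matrix_left_invertible_injective by blast
  have S: "c \<in> ?S \<longleftrightarrow> ?D *v c = a *s c" for c
    by (auto simp: vec_eq_iff diagonal_matrix_vector)
  have BPc: "B *v (P *v c) = P *v (?D *v c)" for c
    by (simp add: matrix_vector_mul_assoc BP)
  \<comment> \<open>\<open>?S\<close> is the eigenspace of the diagonal matrix; \<open>P\<close> maps it onto that of \<open>B\<close>\<close>
  have iff: "B *v (P *v c) = a *s (P *v c) \<longleftrightarrow> c \<in> ?S" for c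
    unfolding S BPc matrix_vector_mult_smult [symmetric]
    using inj by (simp add: inj_eq)
  have surj: "\<exists>c. x = P *v c" for x
    by (rule exI[of _ "Q *v x"]) (simp add: matrix_vector_mul_assoc PQ)
  have "{x. B *v x = a *s x} = (*v) P ` ?S"
  proof (intro set_eqI iffI)
    fix x assume x: "x \<in> {x. B *v x = a *s x}"
    obtain c where c: "x = P *v c" using surj by blast
    then show "x \<in> (*v) P ` ?S" using x iff[of c] by blast
  next
    fix x assume "x \<in> (*v) P ` ?S"
    then show "x \<in> {x. B *v x = a *s x}" using iff by blast
  qed
  then have "vec.dim {x. B *v x = a *s x} = vec.dim ?S"
    using vec.dim_image_eq[OF matrix_vector_mul_linear_gen, of P ?S] inj
    by (simp add: inj_on_subset)
  also have "\<dots> = card {i. d i = a}" by (rule dim_substandard_cart)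
  also have "\<dots> = order a (charpoly B)"
    using charpoly_similar[OF PQ BP] order_prod_linear[of UNIV a d] by (simp add: charpoly_diagonal)
  finally show ?thesis by simp
qed

lemma charpoly_nonzero_hermitian:
  fixes B :: "complex^'n^'n"
  assumes "hermitian_transpose B = B"
  shows "charpoly B \<noteq> 0"
proof -
  obtain P Q :: "complex^'n^'n" and d where "P ** Q = mat 1" "B ** P = P ** diagonal_matrix d"
    using hermitian_diagonalizable[OF assms] by metis
  then show ?thesis by (simp add: charpoly_similar charpoly_diagonal)
qed

section \<open>Norm, maximal singular subspace and numerical radius\<close>

lemma norm_matrix_vector_le: "norm (A *v x) \<le> norm2 A * norm x" for A :: "complex^'n^'n"
  by (rule onorm) simp

lemma inner_gram: "((hermitian_transpose A ** A) *v x) \<bullet> x = (norm (A *v x))\<^sup>2"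
  for A :: "complex^'n^'n"
  by (simp add: matrix_vector_mul_assoc [symmetric] inner_hermitian_transpose power2_norm_eq_inner)

text \<open>The form of \<open>A\<^sup>* A\<close> is \<open>\<parallel>A x\<parallel>\<^sup>2\<close>, bounded by \<open>\<parallel>A\<parallel>\<^sup>2 \<parallel>x\<parallel>\<^sup>2\<close>; its maximizers are eigenvectors.\<close>

lemma V_max_eq_eigenspace:
  fixes A :: "complex^'n^'n"
  shows "V_max A = {x. (hermitian_transpose A ** A) *v x = of_real ((norm2 A)\<^sup>2) *s x}"
    (is "_ = {x. ?B *v x = _}")
proof (intro set_eqI iffI)
  fix x assume "x \<in> V_max A"
  then have x: "norm (A *v x) = norm2 A * norm x" by (simp add: V_max_def)
  have "?B *v x = (norm2 A)\<^sup>2 *\<^sub>R x"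
  proof (rule selfadjoint_maximizer_is_eigenvector[OF linear_matrix_vector _ subspace_UNIV])
    fix y :: "complex^'n"
    have "(norm (A *v y))\<^sup>2 \<le> (norm2 A * norm y)\<^sup>2"
      by (rule power_mono[OF norm_matrix_vector_le]) simp
    then show "(?B *v y) \<bullet> y \<le> (norm2 A)\<^sup>2 * (y \<bullet> y)"
      by (simp add: inner_gram power_mult_distrib power2_norm_eq_inner)
    show "(?B *v y) \<bullet> z = y \<bullet> (?B *v z)" for z
      by (simp add: inner_hermitian_transpose hermitian_gram)
    show "(?B *v x) \<bullet> x = (norm2 A)\<^sup>2 * (x \<bullet> x)"
      by (simp add: inner_gram x power_mult_distrib power2_norm_eq_inner)
  qed auto
  then show "x \<in> {x. ?B *v x = of_real ((norm2 A)\<^sup>2) *s x}" by (simp add: scaleR_eq_smult)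
next
  fix x assume "x \<in> {x. ?B *v x = of_real ((norm2 A)\<^sup>2) *s x}"
  then have "?B *v x = (norm2 A)\<^sup>2 *\<^sub>R x" by (simp add: scaleR_eq_smult)
  then have "(norm (A *v x))\<^sup>2 = (norm2 A * norm x)\<^sup>2"
    using inner_gram[of A x] by (simp add: power_mult_distrib power2_norm_eq_inner)
  moreover have "0 \<le> norm2 A" by (rule onorm_pos_le) simp
  ultimately show "x \<in> V_max A" by (simp add: V_max_def power2_eq_iff_nonneg)
qed

text \<open>By compactness of the unit sphere the operator norm is attained. This is what makes \<open>\<parallel>A\<parallel>\<close> a
singular value.\<close>

lemma V_max_nontrivial:
  fixes A :: "complex^'n^'n"
  obtains v where "v \<in> V_max A" "v \<noteq> 0"
proof -
  let ?S = "sphere 0 1 :: (complex^'n) set"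
  have "axis undefined 1 \<in> ?S" by (simp add: norm_axis_1)
  then have "?S \<noteq> {}" by blast
  moreover have "continuous_on ?S (\<lambda>x. norm (A *v x))" by (intro continuous_intros)
  ultimately obtain v where v: "norm v = 1" and max: "\<And>x. norm x = 1 \<Longrightarrow> norm (A *v x) \<le> norm (A *v v)"
    using continuous_attains_sup[OF compact_sphere, of "0 :: complex^'n" 1 "\<lambda>x. norm (A *v x)"] by auto
  have "norm2 A \<le> norm (A *v v)"
  proof (rule onorm_le)
    fix x :: "complex^'n"
    show "norm (A *v x) \<le> norm (A *v v) * norm x"
    proof (cases "x = 0")
      case False
      have "norm (A *v ((1 / norm x) *\<^sub>R x)) \<le> norm (A *v v)"
        by (rule max) (simp add: False)
      moreover have "A *v ((1 / norm x) *\<^sub>R x) = (1 / norm x) *\<^sub>R (A *v x)"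
        by (rule linear_scale[OF linear_matrix_vector])
      ultimately show ?thesis using False by (simp add: field_simps)
    qed simp
  qed
  then have "v \<in> V_max A"
    using norm_matrix_vector_le[of A v] v by (simp add: V_max_def)
  moreover have "v \<noteq> 0" using v by auto
  ultimately show thesis by (rule that)
qed

lemma sv_multiplicity_eq_dim:
  fixes A :: "complex^'n^'n"
  shows "sv_multiplicity A \<sigma> = vec.dim {x. (hermitian_transpose A ** A) *v x = of_real (\<sigma>\<^sup>2) *s x}"
  unfolding sv_multiplicity_def by (rule order_charpoly_hermitian[OF hermitian_gram])

lemma singular_values_iff:
  fixes A :: "complex^'n^'n"
  shows "\<sigma> \<in> singular_values A \<longleftrightarrow>
    0 \<le> \<sigma> \<and> (\<exists>x. x \<noteq> 0 \<and> (hermitian_transpose A ** A) *v x = of_real (\<sigma>\<^sup>2) *s x)"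
proof -
  have "poly (charpoly (hermitian_transpose A ** A)) (of_real (\<sigma>\<^sup>2)) = 0
      \<longleftrightarrow> sv_multiplicity A \<sigma> \<noteq> 0"
    unfolding sv_multiplicity_def order_root
    using charpoly_nonzero_hermitian[OF hermitian_gram] by blast
  then show ?thesis
    unfolding singular_values_def sv_multiplicity_eq_dim vec.dim_eq_0 by auto
qed

lemma sigma_max_eq_norm2: "sigma_max A = norm2 A" for A :: "complex^'n^'n"
  unfolding sigma_max_def
proof (rule Max_eqI)
  let ?p = "charpoly (hermitian_transpose A ** A)"
  have "finite ((\<lambda>\<sigma>. complex_of_real (\<sigma>\<^sup>2)) ` singular_values A)"
    by (rule finite_subset[OF _ poly_roots_finite[OF charpoly_nonzero_hermitian[OF hermitian_gram[of A]]]])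
      (auto simp: singular_values_def)
  moreover have "inj_on (\<lambda>\<sigma>. complex_of_real (\<sigma>\<^sup>2)) (singular_values A)"
    by (rule inj_onI) (simp add: singular_values_def flip: of_real_power)
  ultimately show "finite (singular_values A)" by (rule finite_imageD)
next
  have n: "0 \<le> norm2 A" by (rule onorm_pos_le) simp
  obtain v where "v \<in> V_max A" "v \<noteq> 0" by (rule V_max_nontrivial)
  then show "norm2 A \<in> singular_values A"
    using n unfolding singular_values_iff V_max_eq_eigenspace by blast
  fix \<sigma> assume "\<sigma> \<in> singular_values A"
  then obtain x where \<sigma>: "0 \<le> \<sigma>" and x: "x \<noteq> 0" "(hermitian_transpose A ** A) *v x = \<sigma>\<^sup>2 *\<^sub>R x"
    unfolding singular_values_iff scaleR_eq_smult by blast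
  have "(norm (A *v x))\<^sup>2 = (\<sigma> * norm x)\<^sup>2"
    using inner_gram[of A x] x(2) by (simp add: power_mult_distrib power2_norm_eq_inner)
  then have "\<sigma> * norm x = norm (A *v x)" using \<sigma> by (simp add: power2_eq_iff_nonneg)
  also have "\<dots> \<le> norm2 A * norm x" by (rule norm_matrix_vector_le)
  finally show "\<sigma> \<le> norm2 A" using x(1) by simp
qed

text \<open>The form in which the numerical radius enters: a rotation \<open>c\<close> turns the modulus into a real part,
that is, into a real inner product.\<close>

lemma numerical_radius_bound:
  fixes A :: "complex^'n^'n"
  assumes c: "cmod c = 1"
  shows "(c *s (A *v z)) \<bullet> z \<le> numerical_radius A * (z \<bullet> z)"
proof (cases "z = 0")
  case False
  let ?S = "{z :: complex^'n. norm z = 1}"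
  define w where "w = (1 / norm z) *\<^sub>R z"
  have w: "w \<in> ?S" and zw: "z = norm z *\<^sub>R w" using False by (simp_all add: w_def)
  have "compact ?S" using compact_sphere[of "0 :: complex^'n" 1] by (simp add: sphere_def)
  moreover have "continuous_on ?S (\<lambda>z. cmod (cdot (A *v z) z))"
    unfolding cdot_def matrix_vector_mult_def by (simp, intro continuous_intros)
  \<comment> \<open>boundedness is what allows the supremum in the definition to be used as an upper bound\<close>
  ultimately have "bdd_above ((\<lambda>z. cmod (cdot (A *v z) z)) ` ?S)"
    by (intro bounded_imp_bdd_above compact_imp_bounded compact_continuous_image)
  then have r: "cmod (cdot (A *v w) w) \<le> numerical_radius A"
    unfolding numerical_radius_def by (rule cSUP_upper[OF w])
  have "(c *s (A *v w)) \<bullet> w = Re (c * cdot (A *v w) w)"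
    by (simp add: Re_cdot [symmetric] cdot_smult_left)
  also have "\<dots> \<le> cmod (cdot (A *v w) w)"
    using complex_Re_le_cmod[of "c * cdot (A *v w) w"] c by (simp add: norm_mult)
  finally have "(c *s (A *v w)) \<bullet> w \<le> numerical_radius A" using r by simp
  moreover have "(c *s (A *v z)) \<bullet> z = (norm z)\<^sup>2 * ((c *s (A *v w)) \<bullet> w)"
  proof -
    have "c *s (A *v z) = norm z *\<^sub>R (c *s (A *v w))"
      by (subst zw) (simp add: scaleR_eq_smult matrix_vector_mult_smult mult.commute)
    then have "(c *s (A *v z)) \<bullet> z = (norm z *\<^sub>R (c *s (A *v w))) \<bullet> (norm z *\<^sub>R w)"
      using zw by simp
    then show ?thesis by (simp add: power2_eq_square)
  qed
  ultimately show ?thesis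
    using mult_left_mono[of "(c *s (A *v w)) \<bullet> w" "numerical_radius A" "(norm z)\<^sup>2"]
    by (simp add: power2_norm_eq_inner mult.commute)
qed simp

section \<open>Half-radial matrices\<close>

lemma half_radial_norm2_pos:
  assumes "half_radial A"
  shows "norm2 A > 0"
proof -
  have "(*v) A \<noteq> (\<lambda>x. 0)"
  proof
    assume "(*v) A = (\<lambda>x. 0)"
    then have "A = 0" by (simp add: matrix_eq fun_eq_iff)
    then show False using assms by (simp add: half_radial_def)
  qed
  then show ?thesis by (subst onorm_pos_lt) (auto simp: fun_eq_iff)
qed

lemma inner_imaginary_smult:
  fixes x y :: "complex^'n"
  shows "(\<i> *s x) \<bullet> y = - (x \<bullet> (\<i> *s y))" "(\<i> *s x) \<bullet> (\<i> *s y) = x \<bullet> y"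
  by (simp_all add: inner_vec_def inner_complex_def sum_negf [symmetric] algebra_simps)

text \<open>The heart of the proof. The half-radial bound is tested at \<open>v \<plusminus> u\<close> and \<open>v \<plusminus> \<i> u\<close>, where \<open>u\<close> is the
left singular partner of \<open>v\<close>; the first two tests turn out to be sharp, which makes \<open>v \<plusminus> u\<close>
eigenvectors of \<open>A + A\<^sup>*\<close> for the eigenvalues \<open>\<plusminus>s\<close>.\<close>

lemma half_radial_V_max:
  fixes A :: "complex^'n^'n"
  assumes hr: "half_radial A" and v: "v \<in> V_max A"
  shows "hermitian_transpose A *v v = 0" and "A *v (A *v v) = 0"
proof -
  interpret A: linear "(*v) A" by (rule linear_matrix_vector)
  interpret H: linear "(*v) (hermitian_transpose A)" by (rule linear_matrix_vector)
  define s where "s = norm2 A"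
  have s: "s > 0" using half_radial_norm2_pos[OF hr] by (simp add: s_def)
  have rad: "(c *s (A *v z)) \<bullet> z \<le> s / 2 * (z \<bullet> z)" if "cmod c = 1" for c z
    using numerical_radius_bound[OF that, of A z] hr by (simp add: half_radial_def s_def)
  define u where "u = (1 / s) *\<^sub>R (A *v v)"
  have Av: "A *v v = s *\<^sub>R u" using s by (simp add: u_def)
  have Hu: "hermitian_transpose A *v u = s *\<^sub>R v"
    using v s unfolding V_max_eq_eigenspace u_def H.scale
    by (simp add: matrix_vector_mul_assoc [symmetric] s_def [symmetric] scaleR_eq_smult power2_eq_square)
  have uu: "u \<bullet> u = v \<bullet> v"
  proof -
    have "s * (u \<bullet> u) = s * (v \<bullet> v)"
      using inner_hermitian_transpose[of A v u] by (simp add: Av Hu)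
    then show ?thesis using s by simp
  qed
  let ?a = "(A *v u) \<bullet> u" and ?b = "(A *v u) \<bullet> v"
  have 1: "?a + ?b \<le> 0"
    using rad[of 1 "v + u"] uu by (simp add: A.add Av inner_simps inner_commute algebra_simps)
  have 2: "- ?a + ?b \<le> 0"
    using rad[of "-1" "v - u"] uu
    by (simp add: A.diff Av inner_simps inner_commute algebra_simps)
  have jA: "A *v (\<i> *s x) = \<i> *s (A *v x)" for x by (rule matrix_vector_mult_smult)
  have jR: "\<i> *s (k *\<^sub>R x) = k *\<^sub>R (\<i> *s x)" for k and x :: "complex^'n"
    by (simp add: scaleR_eq_smult mult.commute)
  have jj: "\<i> *s (\<i> *s x) = - x" for x :: "complex^'n" by (simp add: vec_eq_iff)
  have 3: "- ?b - (A *v u) \<bullet> (\<i> *s u) \<le> 0"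
    using rad[of \<i> "v + \<i> *s u"] uu
    by (simp add: A.add Av jA jR jj vector_add_ldistrib inner_simps inner_imaginary_smult
        inner_commute algebra_simps)
  have 4: "- ?b + (A *v u) \<bullet> (\<i> *s u) \<le> 0"
    using rad[of "- \<i>" "v - \<i> *s u"] uu
    by (simp add: A.diff Av jA jR jj vector_ssub_ldistrib inner_simps inner_imaginary_smult
        inner_commute algebra_simps)
  \<comment> \<open>1 and 2 add up to \<open>?b \<le> 0\<close>, 3 and 4 to \<open>?b \<ge> 0\<close>; then 1 and 2 leave only \<open>?a = 0\<close>\<close>
  have a: "?a = 0" and b: "?b = 0" using 1 2 3 4 by linarith+
  have maximizer: "e *\<^sub>R (A *v z + hermitian_transpose A *v z) = s *\<^sub>R z"
    if e: "e = 1 \<or> e = -1" and z: "z = v + e *\<^sub>R u" for e z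
  proof (rule selfadjoint_maximizer_is_eigenvector[of "\<lambda>z. e *\<^sub>R (A *v z + hermitian_transpose A *v z)" UNIV])
    show "linear (\<lambda>z. e *\<^sub>R (A *v z + hermitian_transpose A *v z))"
      by (rule linearI) (simp_all add: A.add A.scale H.add H.scale algebra_simps)
    show "(e *\<^sub>R (A *v x + hermitian_transpose A *v x)) \<bullet> y
        = x \<bullet> (e *\<^sub>R (A *v y + hermitian_transpose A *v y))" for x y
      using inner_hermitian_transpose[of A x y] inner_hermitian_transpose[of "hermitian_transpose A" x y]
      by (simp add: inner_simps)
    have form: "(e *\<^sub>R (A *v x + hermitian_transpose A *v x)) \<bullet> x = 2 * (e * ((A *v x) \<bullet> x))" for x
      using inner_hermitian_transpose[of A x x] by (simp add: inner_simps inner_commute)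
    show "(e *\<^sub>R (A *v x + hermitian_transpose A *v x)) \<bullet> x \<le> s * (x \<bullet> x)" for x
      using rad[of "of_real e" x] e unfolding form by (auto simp: scaleR_eq_smult [symmetric])
    show "(e *\<^sub>R (A *v z + hermitian_transpose A *v z)) \<bullet> z = s * (z \<bullet> z)"
      using e uu a b unfolding form z
      by (auto simp: A.add A.diff A.neg Av inner_simps inner_commute algebra_simps)
  qed auto
  \<comment> \<open>the terms \<open>A v = s u\<close> and \<open>A\<^sup>* u = s v\<close> cancel against the right-hand side of the eigenvector equation\<close>
  have p: "A *v u + hermitian_transpose A *v v = 0"
    using maximizer[of 1 "v + u"] by (simp add: A.add H.add Av Hu algebra_simps)
  have m: "A *v u - hermitian_transpose A *v v = 0"
    using maximizer[of "-1" "v - u"] by (simp add: A.diff H.diff Av Hu algebra_simps)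
  have "2 *\<^sub>R (A *v u) = 0" using p m by (simp add: scaleR_2 algebra_simps)
  then have "A *v u = 0" by simp
  then show "hermitian_transpose A *v v = 0" and "A *v (A *v v) = 0"
    using p by (simp_all add: Av A.scale)
qed

lemma subspace_range_null: "vec.subspace (range_space A \<inter> null_space A)"
proof -
  have "vec.subspace (range_space A)"
    unfolding range_space_def
    by (intro vec.linear_subspace_image matrix_vector_mul_linear_gen vec.subspace_UNIV)
  moreover have "vec.subspace (null_space A)"
    unfolding null_space_def by (intro vec.linear_subspace_kernel matrix_vector_mul_linear_gen)
  ultimately show ?thesis by (rule vec.subspace_inter)
qed

theorem lemma6:
  fixes A :: "complex^'n^'n" and m :: nat
  assumes "half_radial A"
    and "m = sv_multiplicity A (sigma_max A)"
  shows "(V_max A \<subseteq> range_space (hermitian_transpose A) \<inter> null_space (hermitian_transpose A) \<and>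
          U_max A \<subseteq> range_space A \<inter> null_space A) \<and>
         (\<forall>v\<in>V_max A. \<forall>u\<in>U_max A. cdot v u = 0) \<and>
         real m \<le> real CARD('n) / 2 \<and>
         m \<le> sv_multiplicity A 0"
proof -
  let ?s = "norm2 A"
  have s: "?s > 0" by (rule half_radial_norm2_pos[OF assms(1)])
  have V: "V_max A \<subseteq> range_space (hermitian_transpose A) \<inter> null_space (hermitian_transpose A)"
  proof
    fix v assume v: "v \<in> V_max A"
    then have "hermitian_transpose A *v (A *v v) = of_real (?s\<^sup>2) *s v"
      by (simp add: V_max_eq_eigenspace matrix_vector_mul_assoc)
    then have "v = hermitian_transpose A *v (of_real (1 / ?s\<^sup>2) *s (A *v v))"
      using s by (simp add: matrix_vector_mult_smult)
    then have "v \<in> range_space (hermitian_transpose A)"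
      unfolding range_space_def by (rule range_eqI)
    then show "v \<in> range_space (hermitian_transpose A) \<inter> null_space (hermitian_transpose A)"
      using half_radial_V_max(1)[OF assms(1) v] by (simp add: null_space_def)
  qed
  have U: "U_max A \<subseteq> range_space A \<inter> null_space A"
    unfolding U_max_def
  proof (rule vec.span_minimal[OF _ subspace_range_null], clarify)
    fix u assume "left_singular_vector A (sigma_max A) u"
    then obtain v where v: "norm v = 1" "norm u = 1" "A *v v = of_real ?s *s u"
      by (auto simp: left_singular_vector_def sigma_max_eq_norm2)
    then have "norm (A *v v) = ?s * norm v"
      using s by (simp add: scaleR_eq_smult [symmetric])
    then have "A *v (A *v v) = 0"
      by (intro half_radial_V_max(2)[OF assms(1)]) (simp add: V_max_def)
    moreover have u: "u = A *v (of_real (1 / ?s) *s v)"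
      using v(3) s by (simp add: matrix_vector_mult_smult)
    ultimately have "A *v u = 0" by (simp add: matrix_vector_mult_smult)
    then show "u \<in> range_space A \<inter> null_space A"
      using u by (auto simp: null_space_def range_space_def)
  qed
  have orth: "cdot v u = 0" if v: "v \<in> V_max A" and u: "u \<in> U_max A" for v u
  proof -
    obtain w where "v = hermitian_transpose A *v w" using V v by (auto simp: range_space_def)
    then have "cdot v u = cdot w (A *v u)" by (simp add: cdot_hermitian_transpose)
    also have "A *v u = 0" using U u by (auto simp: null_space_def)
    finally show ?thesis by (simp add: cdot_def)
  qed
  have VN: "V_max A \<inter> null_space A \<subseteq> {0}"
    using s by (auto simp: V_max_def null_space_def)
  have subV: "vec.subspace (V_max A)"
    unfolding V_max_eq_eigenspace
    by (auto intro!: vec.subspaceI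
        simp: matrix_vector_mult_smult matrix_vector_right_distrib vector_add_ldistrib mult.commute)
  have subN: "vec.subspace (null_space A)"
    unfolding null_space_def by (intro vec.linear_subspace_kernel matrix_vector_mul_linear_gen)
  have dimV: "m = vec.dim (V_max A)"
    unfolding assms(2) sigma_max_eq_norm2 sv_multiplicity_eq_dim V_max_eq_eigenspace ..
  have dimN: "sv_multiplicity A 0 = vec.dim (null_space A)"
  proof -
    have "{x. (hermitian_transpose A ** A) *v x = 0} = null_space A"
    proof (intro set_eqI iffI)
      fix x assume "x \<in> {x. (hermitian_transpose A ** A) *v x = 0}"
      then show "x \<in> null_space A" using inner_gram[of A x] by (simp add: null_space_def)
    qed (simp add: null_space_def matrix_vector_mul_assoc [symmetric])
    then show ?thesis by (simp add: sv_multiplicity_eq_dim)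
  qed
  have "inj_on ((*v) A) (V_max A)"
  proof (rule inj_onI)
    fix x y assume xy: "x \<in> V_max A" "y \<in> V_max A" "A *v x = A *v y"
    then have "x - y \<in> V_max A \<inter> null_space A"
      using vec.subspace_diff[OF subV] by (simp add: null_space_def matrix_vector_mult_diff_distrib)
    then show "x = y" using VN by auto
  qed
  then have "vec.dim ((*v) A ` V_max A) = vec.dim (V_max A)"
    by (intro vec.dim_image_eq matrix_vector_mul_linear_gen)
      (simp add: vec.span_eq_iff[THEN iffD2, OF subV])
  moreover have "(*v) A ` V_max A \<subseteq> null_space A"
    using half_radial_V_max(2)[OF assms(1)] by (auto simp: null_space_def)
  ultimately have le: "m \<le> sv_multiplicity A 0"
    unfolding dimV dimN using vec.dim_subset by metis
  have "vec.dim (V_max A) + vec.dim (null_space A)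
      = vec.dim {x + y |x y. x \<in> V_max A \<and> y \<in> null_space A} + vec.dim (V_max A \<inter> null_space A)"
    by (rule vec.dim_sums_Int[OF subV subN, symmetric])
  also have "\<dots> \<le> CARD('n)"
    using VN vec.dim_subset_UNIV[of "{x + y |x y. x \<in> V_max A \<and> y \<in> null_space A}"]
    by (simp add: vec.dimension_def card_cart_basis vec.dim_eq_0[THEN iffD2])
  finally have "2 * m \<le> CARD('n)" using le dimV dimN by simp
  then show ?thesis using V U orth le by auto
qed

end
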